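(* Let $G$ be a $2$-edge-connected graph containing a non-separating cycle $C$. Suppose there is an edge subset $M \subseteq E(C)$ such that $G - M$ admits a nowhere-zero $4$-flow. Then $G$ has a $5$-CDC $\mathcal S$ with $C \in \mathcal S$.
   Context: Graphs are finite and may have parallel edges and loops. A cycle is a graph (here a subgraph of $G$) in which every vertex has even degree. A subgraph $C$ of a connected graph $H$ is non-separating if $H - E(C)$ is connected. A cycle double cover (CDC) of $G$ is a set of cycles of $G$ such that every edge of $G$ lies in the edge sets of exactly two of them; a $k$-CDC is a CDC consisting of $k$ cycles.
   Formalization: A cycle double cover is taken as a multiset of five cycles (repeated and edgeless members allowed) rather than a set of distinct cycles; with distinct cycles the claim fails, e.g. for one vertex with a single loop and C = G. *)

theory Defs
  imports Main "HOL-Library.Uprod" "HOL-Library.Multiset"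
begin

record ('v, 'e) mgraph =
  verts :: "'v set"
  edges :: "'e set"
  ends :: "'e \<Rightarrow> 'v uprod"

text \<open>Finite graphs with parallel edges and loops; a loop at \<open>v\<close> has ends \<open>Upair v v\<close>.
  The graph without vertices is admitted, so that it may occur as a subgraph.\<close>

definition fin_graph :: "('v, 'e) mgraph \<Rightarrow> bool" where
  "fin_graph G \<longleftrightarrow> finite (verts G) \<and> finite (edges G) \<and>
     (\<forall>e\<in>edges G. set_uprod (ends G e) \<subseteq> verts G)"

text \<open>The end map is total, so its values outside the edge set carry no meaning. A subgraph keeps the
  whole map, which makes it determined by its vertex and edge sets.\<close>

definition subgraph :: "('v, 'e) mgraph \<Rightarrow> ('v, 'e) mgraph \<Rightarrow> bool" where
  "subgraph H G \<longleftrightarrow> fin_graph H \<and> fin_graph G \<and>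
     verts H \<subseteq> verts G \<and> edges H \<subseteq> edges G \<and> ends H = ends G"

definition delete_edges :: "('v, 'e) mgraph \<Rightarrow> 'e set \<Rightarrow> ('v, 'e) mgraph" where
  "delete_edges G F = G\<lparr>edges := edges G - F\<rparr>"

text \<open>The second summand makes every loop count twice.\<close>

definition degree :: "('v, 'e) mgraph \<Rightarrow> 'v \<Rightarrow> nat" where
  "degree G v = card {e \<in> edges G. v \<in> set_uprod (ends G e)} +
                card {e \<in> edges G. ends G e = Upair v v}"

definition adjacent :: "('v, 'e) mgraph \<Rightarrow> 'v \<Rightarrow> 'v \<Rightarrow> bool" where
  "adjacent G u v \<longleftrightarrow> (\<exists>e\<in>edges G. ends G e = Upair u v)"

definition connected_graph :: "('v, 'e) mgraph \<Rightarrow> bool" where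
  "connected_graph G \<longleftrightarrow> verts G \<noteq> {} \<and>
     (\<forall>u\<in>verts G. \<forall>v\<in>verts G. (adjacent G)\<^sup>*\<^sup>* u v)"

definition edge_connected :: "nat \<Rightarrow> ('v, 'e) mgraph \<Rightarrow> bool" where
  "edge_connected k G \<longleftrightarrow>
     (\<forall>F. F \<subseteq> edges G \<and> card F < k \<longrightarrow> connected_graph (delete_edges G F))"

definition cycle :: "('v, 'e) mgraph \<Rightarrow> bool" where
  "cycle C \<longleftrightarrow> fin_graph C \<and> (\<forall>v\<in>verts C. even (degree C v))"

definition non_separating :: "('v, 'e) mgraph \<Rightarrow> ('v, 'e) mgraph \<Rightarrow> bool" where
  "non_separating C H \<longleftrightarrow> subgraph C H \<and> connected_graph (delete_edges H (edges C))"

definition orientation ::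
    "('v, 'e) mgraph \<Rightarrow> ('e \<Rightarrow> 'v) \<Rightarrow> ('e \<Rightarrow> 'v) \<Rightarrow> bool" where
  "orientation G t h \<longleftrightarrow> (\<forall>e\<in>edges G. ends G e = Upair (t e) (h e))"

definition has_nowhere_zero_flow :: "nat \<Rightarrow> ('v, 'e) mgraph \<Rightarrow> bool" where
  "has_nowhere_zero_flow k G \<longleftrightarrow>
     (\<exists>t h. \<exists>f :: 'e \<Rightarrow> int. orientation G t h \<and>
        (\<forall>v\<in>verts G. (\<Sum>e\<in>{e\<in>edges G. t e = v}. f e) = (\<Sum>e\<in>{e\<in>edges G. h e = v}. f e)) \<and>
        (\<forall>e\<in>edges G. 0 < \<bar>f e\<bar> \<and> \<bar>f e\<bar> < int k))"

text \<open>A double cover is a multiset of cycles: if \<open>G\<close> is a single circuit, its only double cover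
  uses \<open>G\<close> twice. Edgeless members are allowed.\<close>

definition cycle_double_cover ::
    "('v, 'e) mgraph \<Rightarrow> ('v, 'e) mgraph multiset \<Rightarrow> bool" where
  "cycle_double_cover G S \<longleftrightarrow> (\<forall>C\<in>#S. subgraph C G \<and> cycle C) \<and>
     (\<forall>e\<in>edges G. size {#C \<in># S. e \<in> edges C#} = 2)"

definition k_cdc :: "nat \<Rightarrow> ('v, 'e) mgraph \<Rightarrow> ('v, 'e) mgraph multiset \<Rightarrow> bool" where
  "k_cdc k G S \<longleftrightarrow> cycle_double_cover G S \<and> size S = k"

end

theory Submission
  imports Defs
begin

text \<open>Let \<open>f\<close> be the 4-flow of \<open>G - M\<close>, let \<open>A\<close> be the set of edges with odd flow and \<open>D\<close> the set of
  edges with flow \<open>\<plusminus>2\<close>. Then \<open>A\<close> is even, and across a component of \<open>A\<close> only edges of \<open>D\<close> run, an even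
  number of them by conservation. Hence \<open>A\<close> contains a join \<open>J\<close> for the odd vertices of \<open>D\<close>, so that
  \<open>B = D \<triangle> J\<close> is even and \<open>A \<union> B = E - M\<close>.

  As \<open>C\<close> is even and \<open>A \<union> B\<close> contains every edge outside \<open>C\<close>, the four sets \<open>A \<inter> B\<close>, \<open>A - B\<close>, \<open>B - A\<close>
  and \<open>C \<triangle> (A \<union> B)\<close> cover edges of \<open>C\<close> once and the other edges twice, and they all have the same odd
  vertices. Since \<open>G - E(C)\<close> is connected, it contains a join for these vertices. Its symmetric
  difference with each of the four sets is even, and this does not change how often an edge outside
  \<open>C\<close> is covered, because two out of four becomes two out of four.\<close>

text \<open>Depends on \<open>ends\<close> alone and is always intersected with an edge set, so
  \<open>G\<close> and its subgraphs share the same cuts.\<close>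

definition edge_cut :: "('v, 'e) mgraph \<Rightarrow> 'v set \<Rightarrow> 'e set" where
  "edge_cut G K = {e. \<exists>u w. ends G e = Upair u w \<and> u \<in> K \<and> w \<notin> K}"

text \<open>Loops at \<open>v\<close> are not in \<open>edge_cut G {v}\<close>, which does not matter for the parity of the degree.\<close>

definition odd_at :: "('v, 'e) mgraph \<Rightarrow> 'e set \<Rightarrow> 'v \<Rightarrow> bool" where
  "odd_at G F v \<longleftrightarrow> odd (card (F \<inter> edge_cut G {v}))"

section \<open>Parity of edge sets at vertices and across cuts\<close>

lemma mem_edge_cut_iff:
  assumes "ends G e = Upair u w"
  shows "e \<in> edge_cut G K \<longleftrightarrow> (u \<in> K) \<noteq> (w \<in> K)"
  using assms unfolding edge_cut_def by (auto simp: Upair_inject)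

lemma odd_card_sym_diff:
  assumes "finite X" "finite Y"
  shows "odd (card (sym_diff X Y)) \<longleftrightarrow> odd (card X) \<noteq> odd (card Y)"
proof -
  have X: "card X = card (X - Y) + card (X \<inter> Y)"
    using assms card_Int_Diff[of X Y] by simp
  have Y: "card Y = card (Y - X) + card (X \<inter> Y)"
    using assms card_Int_Diff[of Y X] by (simp add: Int_commute)
  have "card (sym_diff X Y) = card (X - Y) + card (Y - X)"
    using assms by (intro card_Un_disjoint) auto
  then show ?thesis using X Y by presburger
qed

lemma odd_at_sym_diff:
  assumes "finite X" "finite Y"
  shows "odd_at G (sym_diff X Y) v \<longleftrightarrow> odd_at G X v \<noteq> odd_at G Y v"
proof -
  have "sym_diff X Y \<inter> edge_cut G {v} = sym_diff (X \<inter> edge_cut G {v}) (Y \<inter> edge_cut G {v})" by blast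
  then show ?thesis unfolding odd_at_def using assms by (simp add: odd_card_sym_diff)
qed

text \<open>The edges at \<open>v\<close> are its cut edges and its loops; \<open>degree\<close>
  counts the loops once more, so they vanish modulo 2.\<close>

lemma even_degree_iff:
  assumes "finite (edges G)"
  shows "even (degree G v) \<longleftrightarrow> \<not> odd_at G (edges G) v"
proof -
  let ?L = "{e \<in> edges G. ends G e = Upair v v}"
  have "{e \<in> edges G. v \<in> set_uprod (ends G e)} = (edges G \<inter> edge_cut G {v}) \<union> ?L" (is "?I = _")
  proof (intro set_eqI)
    fix e
    obtain u w where "ends G e = Upair u w" by (cases "ends G e") auto
    from this mem_edge_cut_iff[OF this] show "e \<in> ?I \<longleftrightarrow> e \<in> (edges G \<inter> edge_cut G {v}) \<union> ?L"
      by auto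
  qed
  moreover have "(edges G \<inter> edge_cut G {v}) \<inter> ?L = {}" using mem_edge_cut_iff by fastforce
  ultimately have "card ?I = card (edges G \<inter> edge_cut G {v}) + card ?L"
    using assms by (simp add: card_Un_disjoint)
  then show ?thesis unfolding degree_def odd_at_def by auto
qed

text \<open>Handshake argument: the cut of \<open>K\<close> is the sum modulo 2 of the cuts of its
  vertices, since edges inside \<open>K\<close> occur twice.\<close>

lemma odd_card_edge_cut:
  assumes "finite K" "finite F"
  shows "odd (card (F \<inter> edge_cut G K)) \<longleftrightarrow> odd (card {v \<in> K. odd_at G F v})"
  using assms(1)
proof (induction K)
  case empty
  then show ?case by (simp add: edge_cut_def)
next
  case (insert x K)
  have "e \<in> edge_cut G (insert x K) \<longleftrightarrow> e \<in> sym_diff (edge_cut G {x}) (edge_cut G K)" for e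
  proof -
    obtain u w where "ends G e = Upair u w" by (cases "ends G e") auto
    from mem_edge_cut_iff[OF this] show ?thesis using insert.hyps by auto
  qed
  then have "F \<inter> edge_cut G (insert x K) = sym_diff (F \<inter> edge_cut G {x}) (F \<inter> edge_cut G K)" by blast
  then have "odd (card (F \<inter> edge_cut G (insert x K))) \<longleftrightarrow> odd_at G F x \<noteq> odd (card (F \<inter> edge_cut G K))"
    using assms(2) unfolding odd_at_def by (simp add: odd_card_sym_diff)
  also have "\<dots> \<longleftrightarrow> odd (card {v \<in> insert x K. odd_at G F v})"
  proof (cases "odd_at G F x")
    case True
    then have "{v \<in> insert x K. odd_at G F v} = insert x {v \<in> K. odd_at G F v}" by auto
    then show ?thesis using True insert by simp
  next
    case False
    then have "{v \<in> insert x K. odd_at G F v} = {v \<in> K. odd_at G F v}" by auto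
    then show ?thesis using False insert by simp
  qed
  finally show ?case .
qed

lemma odd_at_imp_verts:
  assumes "fin_graph G" "F \<subseteq> edges G" "odd_at G F v"
  shows "v \<in> verts G"
proof -
  obtain e where "e \<in> F" "e \<in> edge_cut G {v}"
    using assms(3) unfolding odd_at_def by (metis IntE card.empty equals0I even_zero)
  then show ?thesis using assms(1,2) unfolding fin_graph_def edge_cut_def by fastforce
qed

section \<open>Joins with prescribed odd vertices\<close>

lemma adjacent_rtranclp_sym: "(adjacent G)\<^sup>*\<^sup>* u v \<longleftrightarrow> (adjacent G)\<^sup>*\<^sup>* v u"
proof -
  have "symp (adjacent G)" by (auto intro!: sympI simp: adjacent_def) (metis Upair_inject)
  then show ?thesis by (meson symp_rtranclp sympD)
qed

text \<open>The edges of a walk are added modulo 2, so repeated edges cancel and no simple path has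
  to be extracted.\<close>

lemma path_join:
  assumes "(adjacent G)\<^sup>*\<^sup>* u w" "finite (edges G)"
  shows "\<exists>P\<subseteq>edges G. \<forall>v. odd_at G P v \<longleftrightarrow> (v = u) \<noteq> (v = w)"
  using assms(1)
proof (induction rule: rtranclp_induct)
  case base
  show ?case by (rule exI[of _ "{}"]) (simp add: odd_at_def)
next
  case (step y z)
  then obtain P where P: "P \<subseteq> edges G" "\<forall>v. odd_at G P v \<longleftrightarrow> (v = u) \<noteq> (v = y)" by blast
  obtain e where e: "e \<in> edges G" "ends G e = Upair y z"
    using step.hyps by (auto simp: adjacent_def)
  have "odd_at G {e} v \<longleftrightarrow> (v = y) \<noteq> (v = z)" for v
    unfolding odd_at_def using mem_edge_cut_iff[OF e(2), of "{v}"]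
    by (cases "e \<in> edge_cut G {v}") auto
  then have "odd_at G (sym_diff P {e}) v \<longleftrightarrow> (v = u) \<noteq> (v = z)" for v
    using odd_at_sym_diff[of P "{e}" G v] P(2) finite_subset[OF P(1) assms(2)] by auto
  then show ?case using P(1) e(1) by (intro exI[of _ "sym_diff P {e}"]) auto
qed

text \<open>Two vertices of \<open>T\<close> in one component are removed together, and a path
  between them is added modulo 2 to a join for the rest.\<close>

lemma join_exists:
  assumes "finite (edges G)" "finite T"
    and "\<And>u. u \<in> T \<Longrightarrow> even (card {v \<in> T. (adjacent G)\<^sup>*\<^sup>* u v})"
  shows "\<exists>J\<subseteq>edges G. \<forall>v. odd_at G J v \<longleftrightarrow> v \<in> T"
  using assms(2,3)
proof (induction T rule: finite_psubset_induct)
  case (psubset T)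
  show ?case
  proof (cases "T = {}")
    case True
    then show ?thesis by (intro exI[of _ "{}"]) (simp add: odd_at_def)
  next
    case False
    then obtain u where u: "u \<in> T" by blast
    \<comment> \<open>An even count is not 1, so \<open>u\<close> has a partner in its
      component.\<close>
    have "{v \<in> T. (adjacent G)\<^sup>*\<^sup>* u v} \<noteq> {u}" using psubset.prems[OF u] by auto
    then obtain w where w: "w \<in> T" "w \<noteq> u" "(adjacent G)\<^sup>*\<^sup>* u w" using u by blast
    have "even (card {v \<in> T - {u, w}. (adjacent G)\<^sup>*\<^sup>* x v})" if x: "x \<in> T - {u, w}" for x
    proof (cases "(adjacent G)\<^sup>*\<^sup>* x u")
      case True
      then have xw: "(adjacent G)\<^sup>*\<^sup>* x w" using w(3) by simp
      have "{v \<in> T - {u, w}. (adjacent G)\<^sup>*\<^sup>* x v} = {v \<in> T. (adjacent G)\<^sup>*\<^sup>* x v} - {u, w}" by auto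
      moreover have "card \<dots> = card {v \<in> T. (adjacent G)\<^sup>*\<^sup>* x v} - card {u, w}"
        using True xw u w by (intro card_Diff_subset) auto
      ultimately show ?thesis using psubset.prems[of x] x w(2) by auto
    next
      case False
      then have "\<not> (adjacent G)\<^sup>*\<^sup>* x w" using w(3) by (meson adjacent_rtranclp_sym rtranclp_trans)
      then have "{v \<in> T - {u, w}. (adjacent G)\<^sup>*\<^sup>* x v} = {v \<in> T. (adjacent G)\<^sup>*\<^sup>* x v}"
        using False by auto
      then show ?thesis using psubset.prems[of x] x by auto
    qed
    moreover have "T - {u, w} \<subset> T" using u by blast
    ultimately obtain J where J: "J \<subseteq> edges G" "\<forall>v. odd_at G J v \<longleftrightarrow> v \<in> T - {u, w}"
      using psubset.IH[of "T - {u, w}"] by auto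
    obtain P where P: "P \<subseteq> edges G" "\<forall>v. odd_at G P v \<longleftrightarrow> (v = u) \<noteq> (v = w)"
      using path_join[OF w(3) assms(1)] by blast
    have "odd_at G (sym_diff J P) v \<longleftrightarrow> v \<in> T" for v
      using odd_at_sym_diff[of J P G v] J(2) P(2) finite_subset[OF J(1) assms(1)]
        finite_subset[OF P(1) assms(1)] u w by auto
    then show ?thesis using J(1) P(1) by (intro exI[of _ "sym_diff J P"]) auto
  qed
qed

lemma odd_at_cong: "ends G = ends H \<Longrightarrow> odd_at G F v = odd_at H F v"
  by (simp add: odd_at_def edge_cut_def)

section \<open>From a nowhere-zero 4-flow to two even sets\<close>

lemma flow_across_cut:
  fixes f :: "'e \<Rightarrow> int"
  assumes "finite E" "finite K"
    and "\<And>v. v \<in> K \<Longrightarrow> (\<Sum>e\<in>{e\<in>E. t e = v}. f e) = (\<Sum>e\<in>{e\<in>E. h e = v}. f e)"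
  shows "(\<Sum>e\<in>E. f e * (of_bool (t e \<in> K) - of_bool (h e \<in> K))) = 0"
proof -
  \<comment> \<open>Used for \<open>t\<close> and \<open>h\<close>: it gives the total outflow and
    inflow of the vertices in \<open>K\<close>. Edges with both ends in \<open>K\<close> occur in
    both and cancel in the difference.\<close>
  have g: "(\<Sum>e\<in>E. f e * of_bool (g e \<in> K)) = (\<Sum>v\<in>K. \<Sum>e\<in>{e\<in>E. g e = v}. f e)" for g :: "'e \<Rightarrow> 'a"
  proof -
    have "(\<Sum>v\<in>K. \<Sum>e\<in>{e\<in>E. g e = v}. f e) = (\<Sum>v\<in>K. \<Sum>e\<in>E. if g e = v then f e else 0)"
      using assms(1) by (simp add: sum.inter_filter)
    also have "\<dots> = (\<Sum>e\<in>E. \<Sum>v\<in>K. if g e = v then f e else 0)" by (rule sum.swap)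
    also have "\<dots> = (\<Sum>e\<in>E. f e * of_bool (g e \<in> K))"
      using assms(2) by (intro sum.cong) (auto simp: sum.delta)
    finally show ?thesis by simp
  qed
  show ?thesis using assms(3) by (simp add: right_diff_distrib sum_subtractf g)
qed

lemma sum_of_bool_card:
  assumes "finite E" "D \<subseteq> E"
  shows "(\<Sum>e\<in>E. of_bool (e \<in> D)) = (int (card D))"
proof -
  have "(\<Sum>e\<in>E. of_bool (e \<in> D)) = (\<Sum>e\<in>D. 1 :: int)"
    using assms by (intro sum.mono_neutral_cong_right) auto
  then show ?thesis by simp
qed

text \<open>One direction of the classical equivalence between nowhere-zero 4-flows and covers by
  two even edge sets.\<close>

lemma flow_4_two_even_sets:
  assumes "fin_graph G" "has_nowhere_zero_flow 4 G"
  shows "\<exists>A B. A \<union> B = edges G \<and> (\<forall>v. \<not> odd_at G A v) \<and> (\<forall>v. \<not> odd_at G B v)"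
proof -
  obtain t h and f :: "'b \<Rightarrow> int" where ori: "orientation G t h"
    and cons: "\<forall>v\<in>verts G. (\<Sum>e\<in>{e\<in>edges G. t e = v}. f e) = (\<Sum>e\<in>{e\<in>edges G. h e = v}. f e)"
    and nz: "\<forall>e\<in>edges G. 0 < \<bar>f e\<bar> \<and> \<bar>f e\<bar> < int 4"
    using assms(2) unfolding has_nowhere_zero_flow_def by blast
  have fin: "finite (verts G)" "finite (edges G)" using assms(1) by (auto simp: fin_graph_def)
  define A where "A = {e \<in> edges G. odd (f e)}"
  define D where "D = {e \<in> edges G. even (f e)}"
  have sub: "A \<subseteq> edges G" "D \<subseteq> edges G" and AD: "A \<union> D = edges G" by (auto simp: A_def D_def)
  have finAD: "finite A" "finite D" using sub fin finite_subset by blast+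
  have cut: "e \<in> edge_cut G K \<longleftrightarrow> (t e \<in> K) \<noteq> (h e \<in> K)" if "e \<in> edges G" for e K
    using mem_edge_cut_iff[of G e "t e" "h e" K] ori that by (simp add: orientation_def)
  have cross: "(\<Sum>e\<in>edges G. f e * (of_bool (t e \<in> K) - of_bool (h e \<in> K))) = 0"
    if "K \<subseteq> verts G" for K
    using flow_across_cut[OF fin(2) finite_subset[OF that fin(1)], where t = t and h = h and f = f] cons that
    by blast
  have A_even: "\<not> odd_at G A v" for v
  proof
    assume odd: "odd_at G A v"
    then have v: "{v} \<subseteq> verts G" using odd_at_imp_verts[OF assms(1) sub(1)] by simp
    \<comment> \<open>Modulo 2 the orientation sign disappears, and the net flow out of
      \<open>v\<close> counts the odd edges in its cut.\<close>
    have "2 dvd f e * (of_bool (t e \<in> {v}) - of_bool (h e \<in> {v})) - of_bool (e \<in> A \<inter> edge_cut G {v})"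
      if "e \<in> edges G" for e
      using that cut[OF that, of "{v}"] by (auto simp: A_def)
    then have "2 dvd (\<Sum>e\<in>edges G. f e * (of_bool (t e \<in> {v}) - of_bool (h e \<in> {v}))
        - of_bool (e \<in> A \<inter> edge_cut G {v}))"
      by (rule dvd_sum)
    then have "2 dvd int (card (A \<inter> edge_cut G {v}))"
      using cross[OF v] sum_of_bool_card[OF fin(2) le_infI1[OF sub(1)], of "edge_cut G {v}"]
      unfolding sum_subtractf by auto
    then show False using odd by (simp add: odd_at_def)
  qed
  have D_cut: "even (card (D \<inter> edge_cut G K))" if "K \<subseteq> verts G" "A \<inter> edge_cut G K = {}" for K
  proof -
    \<comment> \<open>All edges of this cut carry 2 or -2, which agree modulo 4. The net flow 0 is
      thus twice the size of the cut modulo 4.\<close>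
    have "4 dvd f e * (of_bool (t e \<in> K) - of_bool (h e \<in> K)) - 2 * of_bool (e \<in> D \<inter> edge_cut G K)"
      if e: "e \<in> edges G" for e
    proof (cases "e \<in> edge_cut G K")
      case True
      then have "e \<in> D" using e AD \<open>A \<inter> edge_cut G K = {}\<close> by blast
      then have "even (f e)" "0 < \<bar>f e\<bar>" "\<bar>f e\<bar> < 4" using bspec[OF nz e] by (simp_all add: D_def)
      then have "f e = 2 \<or> f e = -2" by presburger
      then show ?thesis using True \<open>e \<in> D\<close> cut[OF e, of K] by auto
    next
      case False
      then show ?thesis using cut[OF e, of K] by auto
    qed
    then have "4 dvd (\<Sum>e\<in>edges G. f e * (of_bool (t e \<in> K) - of_bool (h e \<in> K))
        - 2 * of_bool (e \<in> D \<inter> edge_cut G K))"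
      by (rule dvd_sum)
    then have "4 dvd 2 * int (card (D \<inter> edge_cut G K))"
      using cross[OF that(1)] sum_of_bool_card[OF fin(2) le_infI1[OF sub(2)], of "edge_cut G K"]
      unfolding sum_subtractf sum_distrib_left[symmetric] by auto
    then show ?thesis by presburger
  qed
  define H where "H = G\<lparr>edges := A\<rparr>"
  define T where "T = {v. odd_at G D v}"
  have T: "T \<subseteq> verts G" using odd_at_imp_verts[OF assms(1) sub(2)] by (auto simp: T_def)
  have "even (card {v \<in> T. (adjacent H)\<^sup>*\<^sup>* u v})" for u
  proof -
    \<comment> \<open>Intersecting with \<open>verts G\<close> makes \<open>K\<close> finite;
      reachability is reflexive even at a \<open>u\<close> outside the graph.\<close>
    define K where "K = {v \<in> verts G. (adjacent H)\<^sup>*\<^sup>* u v}"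
    have "A \<inter> edge_cut G K = {}"
    proof (rule ccontr)
      assume "A \<inter> edge_cut G K \<noteq> {}"
      then obtain e x y where e: "e \<in> A" "ends G e = Upair x y" "x \<in> K" "y \<notin> K"
        unfolding edge_cut_def by blast
      then have "adjacent H x y" by (auto simp: adjacent_def H_def)
      moreover have "y \<in> verts G" using e sub assms(1) by (fastforce simp: fin_graph_def)
      ultimately show False using e rtranclp.rtrancl_into_rtrancl[of "adjacent H" u x y] by (auto simp: K_def)
    qed
    then have "even (card (D \<inter> edge_cut G K))" by (intro D_cut) (auto simp: K_def)
    then have "even (card {v \<in> K. odd_at G D v})"
      using odd_card_edge_cut[of K D G] fin finAD by (simp add: K_def)
    moreover have "{v \<in> K. odd_at G D v} = {v \<in> T. (adjacent H)\<^sup>*\<^sup>* u v}"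
      using T by (auto simp: K_def T_def)
    ultimately show ?thesis by simp
  qed
  then have "\<exists>J\<subseteq>edges H. \<forall>v. odd_at H J v \<longleftrightarrow> v \<in> T"
    using finAD finite_subset[OF T fin(1)] by (intro join_exists) (auto simp: H_def)
  then obtain J where J: "J \<subseteq> A" "\<forall>v. odd_at G J v \<longleftrightarrow> v \<in> T"
    using odd_at_cong[of H G] by (auto simp: H_def)
  have "\<not> odd_at G (sym_diff D J) v" for v
    using odd_at_sym_diff[of D J G v] J(2) finAD finite_subset[OF J(1) finAD(1)] by (auto simp: T_def)
  \<comment> \<open>Adding \<open>J\<close> changes \<open>D\<close> only inside \<open>A\<close>,
    so the union stays the same.\<close>
  moreover have "A \<union> sym_diff D J = edges G" using J(1) AD by (auto simp: A_def D_def)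
  ultimately show ?thesis using A_even by blast
qed

section \<open>Joins outside the cycle and assembly of the cover\<close>

lemma connected_join:
  assumes "fin_graph G" "connected_graph (delete_edges G X)" "F \<subseteq> edges G"
  shows "\<exists>J\<subseteq>edges G - X. \<forall>v. odd_at G J v \<longleftrightarrow> odd_at G F v"
proof -
  let ?H = "delete_edges G X" and ?T = "{v. odd_at G F v}"
  have fin: "finite (verts G)" "finite (edges G)" "finite F"
    using assms(1,3) by (auto simp: fin_graph_def intro: finite_subset)
  have T: "?T \<subseteq> verts G" using odd_at_imp_verts[OF assms(1,3)] by blast
  \<comment> \<open>With an empty cut around all vertices, the number of odd vertices is even, as a
    join in the single component requires.\<close>
  have "F \<inter> edge_cut G (verts G) = {}"
    using assms(1,3) by (fastforce simp: fin_graph_def edge_cut_def)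
  then have "even (card {v \<in> verts G. odd_at G F v})"
    using odd_card_edge_cut[OF fin(1,3), of G] by simp
  moreover have "{v \<in> verts G. odd_at G F v} = {v \<in> ?T. (adjacent ?H)\<^sup>*\<^sup>* u v}" if "u \<in> ?T" for u
    using T that assms(2) by (auto simp: connected_graph_def delete_edges_def)
  ultimately have "\<exists>J\<subseteq>edges ?H. \<forall>v. odd_at ?H J v \<longleftrightarrow> v \<in> ?T"
    using fin finite_subset[OF T fin(1)] by (intro join_exists) (auto simp: delete_edges_def)
  then show ?thesis using odd_at_cong[of ?H G] by (auto simp: delete_edges_def)
qed

lemma spanning_cycle:
  assumes "fin_graph G" "F \<subseteq> edges G" "\<And>v. \<not> odd_at G F v"
  shows "subgraph (G\<lparr>edges := F\<rparr>) G" "cycle (G\<lparr>edges := F\<rparr>)"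
proof -
  have fin: "fin_graph (G\<lparr>edges := F\<rparr>)"
    using assms(1,2) by (auto simp: fin_graph_def intro: finite_subset)
  then show "subgraph (G\<lparr>edges := F\<rparr>) G"
    using assms(1,2) by (simp add: subgraph_def)
  have "even (degree (G\<lparr>edges := F\<rparr>) v)" for v
    using even_degree_iff[of "G\<lparr>edges := F\<rparr>" v] fin assms(3)[of v]
      odd_at_cong[of "G\<lparr>edges := F\<rparr>" G F v]
    by (simp add: fin_graph_def)
  then show "cycle (G\<lparr>edges := F\<rparr>)" using fin by (simp add: cycle_def)
qed

text \<open>\<open>cycle\<close> speaks only of the vertices of \<open>C\<close>; at any other point
  no edge of \<open>C\<close> ends.\<close>

lemma cycle_not_odd_at:
  assumes "cycle C"
  shows "\<not> odd_at C (edges C) v"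
  using assms even_degree_iff[of C v] odd_at_imp_verts[of C "edges C" v]
  by (auto simp: cycle_def fin_graph_def)

theorem theorem3p2:
  fixes G C :: "('v, 'e) mgraph" and M :: "'e set"
  assumes "fin_graph G" and "edge_connected 2 G"
    and "subgraph C G" and "cycle C" and "non_separating C G"
    and "M \<subseteq> edges C"
    and "has_nowhere_zero_flow 4 (delete_edges G M)"
  shows "\<exists>S. k_cdc 5 G S \<and> C \<in># S"
proof -
  have "fin_graph (delete_edges G M)"
    using assms(1) by (auto simp: fin_graph_def delete_edges_def)
  then obtain A B where AB: "A \<union> B = edges G - M"
    and even: "\<And>v. \<not> odd_at G A v" "\<And>v. \<not> odd_at G B v"
    using flow_4_two_even_sets[OF _ assms(7)] odd_at_cong[of "delete_edges G M" G]
    by (auto simp: delete_edges_def)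
  \<comment> \<open>From here on \<open>D\<close> is the edge set of the given cycle, no longer the
    set of edges with even flow.\<close>
  define D where "D = edges C"
  have D: "D \<subseteq> edges G" "\<not> odd_at G D v" for v
    using assms(3) cycle_not_odd_at[OF assms(4), of v] odd_at_cong[of C G D v]
    by (auto simp: subgraph_def D_def)
  have fin: "finite A" "finite B" "finite D"
    using AB D(1) assms(1) by (auto simp: fin_graph_def intro: finite_subset)
  obtain J where J: "J \<subseteq> edges G - D" "\<And>v. odd_at G J v \<longleftrightarrow> odd_at G (A \<inter> B) v"
    using connected_join[OF assms(1), of D "A \<inter> B"] assms(5) AB
    by (auto simp: non_separating_def D_def)
  have finJ: "finite J" using J(1) assms(1) by (auto simp: fin_graph_def intro: finite_subset)
  note sd = odd_at_sym_diff[of _ _ G]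
  \<comment> \<open>Each of these sets differs from \<open>A \<inter> B\<close> by a sum modulo 2 of
    the even sets \<open>A\<close> and \<open>B\<close>, hence has the odd vertices of
    \<open>J\<close>.\<close>
  have *: "A - B = sym_diff A (A \<inter> B)" "B - A = sym_diff B (A \<inter> B)"
    "A \<union> B = sym_diff (sym_diff A B) (A \<inter> B)" by auto
  have p: "odd_at G (A - B) v \<longleftrightarrow> odd_at G J v" "odd_at G (B - A) v \<longleftrightarrow> odd_at G J v"
    "odd_at G (A \<union> B) v \<longleftrightarrow> odd_at G J v" for v
    using sd[of A "A \<inter> B" v] sd[of B "A \<inter> B" v] sd[of "sym_diff A B" "A \<inter> B" v] sd[of A B v]
      even J(2) fin unfolding *[symmetric] by auto
  \<comment> \<open>A list, so that members which coincide are still counted separately in the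
    multiset.\<close>
  define X where "X = [sym_diff (A \<inter> B) J, sym_diff (A - B) J, sym_diff (B - A) J,
    sym_diff (sym_diff D (A \<union> B)) J]"
  define S where "S = add_mset C (mset (map (\<lambda>F. G\<lparr>edges := F\<rparr>) X))"
  have X: "F \<subseteq> edges G \<and> (\<forall>v. \<not> odd_at G F v)" if "F \<in> set X" for F
  proof -
    have "F \<subseteq> edges G" using that AB J(1) D(1) unfolding X_def by auto
    moreover have "\<not> odd_at G F v" for v
      using that p[of v] J(2)[of v] D(2)[of v] fin finJ
        sd[of "A \<inter> B" J v] sd[of "A - B" J v] sd[of "B - A" J v]
        sd[of "sym_diff D (A \<union> B)" J v] sd[of D "A \<union> B" v]
      unfolding X_def by auto
    ultimately show ?thesis by blast
  qed
  have "\<forall>C'\<in>#S. subgraph C' G \<and> cycle C'"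
    using X spanning_cycle[OF assms(1)] assms(3,4) unfolding S_def by auto
  moreover have "size {#C' \<in># S. e \<in> edges C'#} = 2" if "e \<in> edges G" for e
  proof -
    \<comment> \<open>Outside \<open>D\<close> an edge avoids \<open>M\<close>, so the flow covers
      it; inside \<open>D\<close> the join \<open>J\<close> leaves the single covering by the four
      sets intact, and \<open>C\<close> supplies the second.\<close>
    have "e \<notin> D \<Longrightarrow> e \<in> A \<union> B" "e \<in> D \<Longrightarrow> e \<notin> J" using that AB J(1) assms(6) D_def by auto
    then show ?thesis
      unfolding S_def X_def
      by (cases "e \<in> D"; cases "e \<in> A"; cases "e \<in> B"; cases "e \<in> J") (auto simp: D_def[symmetric])
  qed
  ultimately have "k_cdc 5 G S"
    by (simp add: k_cdc_def cycle_double_cover_def S_def X_def)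
  then show ?thesis by (intro exI[of _ S]) (simp add: S_def)
qed

end
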